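(* If $n\ge 4$ is an even integer then $C_{n,v}=C_{n-1,v}$ for all $1\le v\le\pi(n)$; for $v>\pi(n)$ both sides vanish.
   Context: $p_1=2<p_2=3<\cdots$ are the primes and $\pi(x)$ is the number of primes $\le x$. $K$ is a field containing $\mathbb{Q}$. For a positive integer $n$ put $r=\pi(n)$ and $S=K[x_1,\dots,x_r]$. The weight of a monomial $m=x_1^{a_1}\cdots x_r^{a_r}$ is $w(m)=\prod_i p_i^{a_i}$. $I_n\subset S$ is the monomial ideal generated by all monomials of weight $>n$, and $G(I_n)$ is its minimal monomial generating set. For a monomial $m\ne 1$, $\min(m)$ is the least index $i$ with $a_i>0$. Define $C_{n,v}=\#\{m\in G(I_n):\min(m)=v\}$. *)

theory Defs
  imports
    "HOL-Library.Poly_Mapping"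
    "HOL-Library.Infinite_Set"
    "HOL-Computational_Algebra.Primes"
    "HOL-Algebra.Ideal"
begin

definition nth_prime :: "nat \<Rightarrow> nat" where
  "nth_prime i = enumerate {p :: nat. prime p} (i - 1)"  (* indices start at 1: nth_prime 1 = 2 *)

definition prime_pi :: "nat \<Rightarrow> nat" where
  "prime_pi n = card {p :: nat. prime p \<and> p \<le> n}"

text \<open>
  A monomial $x_1^{a_1} \cdots x_r^{a_r}$ is given by its exponent vector, a finitely supported
  function on the indices with support in $\{1, \dots, r\}$. A polynomial is a finitely supported
  function from exponent vectors to coefficients; its product is the convolution product, and
  \<open>Poly_Mapping.single m 1\<close> is the monomial \<open>m\<close> as a polynomial. In particular the exponent
  vector \<open>0\<close> is the monomial 1 and addition of exponent vectors is multiplication of monomials.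
\<close>

type_synonym mon = "nat \<Rightarrow>\<^sub>0 nat"

definition monomials :: "nat \<Rightarrow> mon set" where
  "monomials r = {m. Poly_Mapping.keys m \<subseteq> {1..r}}"

definition mpoly_ring :: "nat \<Rightarrow> (mon \<Rightarrow>\<^sub>0 'k::field) ring" where
  "mpoly_ring r = \<lparr>carrier = {p. Poly_Mapping.keys p \<subseteq> monomials r},
     mult = (*), one = 1, zero = 0, add = (+)\<rparr>"

definition mon_poly :: "mon \<Rightarrow> (mon \<Rightarrow>\<^sub>0 'k::field)" where
  "mon_poly m = Poly_Mapping.single m 1"

definition mon_generates :: "nat \<Rightarrow> mon set \<Rightarrow> (mon \<Rightarrow>\<^sub>0 'k::field) set \<Rightarrow> bool" where
  "mon_generates r G I \<longleftrightarrow> G \<subseteq> monomials r \<and> Idl\<^bsub>mpoly_ring r\<^esub> (mon_poly ` G) = I"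

definition is_min_mon_gens :: "nat \<Rightarrow> (mon \<Rightarrow>\<^sub>0 'k::field) set \<Rightarrow> mon set \<Rightarrow> bool" where
  "is_min_mon_gens r I G \<longleftrightarrow> mon_generates r G I \<and> (\<forall>H. H \<subset> G \<longrightarrow> \<not> mon_generates r H I)"

(* Unique for a monomial ideal: see ex1_min_mon_gens below. *)
definition min_mon_gens :: "nat \<Rightarrow> (mon \<Rightarrow>\<^sub>0 'k::field) set \<Rightarrow> mon set" where
  "min_mon_gens r I = (THE G. is_min_mon_gens r I G)"

definition weight :: "mon \<Rightarrow> nat" where
  "weight m = (\<Prod>i\<in>Poly_Mapping.keys m. nth_prime i ^ Poly_Mapping.lookup m i)"

definition weight_ideal :: "nat \<Rightarrow> (mon \<Rightarrow>\<^sub>0 'k::field) set" where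
  "weight_ideal n = Idl\<^bsub>mpoly_ring (prime_pi n)\<^esub>
     (mon_poly ` {m \<in> monomials (prime_pi n). weight m > n})"

definition min_index :: "mon \<Rightarrow> nat" where  (* only meaningful for monomials other than 1 *)
  "min_index m = (LEAST i. Poly_Mapping.lookup m i > 0)"

definition num_gens :: "'k::field_char_0 itself \<Rightarrow> nat \<Rightarrow> nat \<Rightarrow> nat" where
  "num_gens K n v = card {m \<in> min_mon_gens (prime_pi n) (weight_ideal n :: (mon \<Rightarrow>\<^sub>0 'k) set).
     m \<noteq> 0 \<and> min_index m = v}"

subsection \<open>Well-definedness\<close>

lemma monomials_zero [simp]: "0 \<in> monomials r"
  by (simp add: monomials_def)

lemma keys_add_nat: "Poly_Mapping.keys (a + b :: mon) = Poly_Mapping.keys a \<union> Poly_Mapping.keys b"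
  by (auto simp: in_keys_iff lookup_add)

lemma monomials_add_iff [simp]: "a + b \<in> monomials r \<longleftrightarrow> a \<in> monomials r \<and> b \<in> monomials r"
  by (auto simp: monomials_def keys_add_nat)

lemma cring_mpoly_ring: "cring (mpoly_ring r :: (mon \<Rightarrow>\<^sub>0 'k::field) ring)"
proof (rule cringI)
  show "abelian_group (mpoly_ring r :: (mon \<Rightarrow>\<^sub>0 'k) ring)"
  proof (rule abelian_groupI)
    fix x y :: "mon \<Rightarrow>\<^sub>0 'k"
    assume "x \<in> carrier (mpoly_ring r)" "y \<in> carrier (mpoly_ring r)"
    then show "x \<oplus>\<^bsub>mpoly_ring r\<^esub> y \<in> carrier (mpoly_ring r)"
      using keys_add[of x y] by (auto simp: mpoly_ring_def)
  next
    fix x :: "mon \<Rightarrow>\<^sub>0 'k"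
    assume "x \<in> carrier (mpoly_ring r)"
    then show "\<exists>y\<in>carrier (mpoly_ring r). y \<oplus>\<^bsub>mpoly_ring r\<^esub> x = \<zero>\<^bsub>mpoly_ring r\<^esub>"
      by (intro bexI[of _ "- x"]) (auto simp: mpoly_ring_def in_keys_iff subset_iff)
  qed (auto simp: mpoly_ring_def add_ac)
  show "Group.comm_monoid (mpoly_ring r :: (mon \<Rightarrow>\<^sub>0 'k) ring)"
  proof (rule comm_monoidI)
    fix x y :: "mon \<Rightarrow>\<^sub>0 'k"
    assume "x \<in> carrier (mpoly_ring r)" "y \<in> carrier (mpoly_ring r)"
    then show "x \<otimes>\<^bsub>mpoly_ring r\<^esub> y \<in> carrier (mpoly_ring r)"
      using keys_mult[of x y] by (fastforce simp: mpoly_ring_def)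
  qed (auto simp: mpoly_ring_def mult_ac)
qed (auto simp: mpoly_ring_def algebra_simps)

lemma mpoly_eq_sum: "p = (\<Sum>m\<in>Poly_Mapping.keys p. Poly_Mapping.single m (Poly_Mapping.lookup p m))"
  by (rule poly_mapping_eqI) (auto simp: lookup_sum lookup_single when_def in_keys_iff)

lemma mem_Idl_mon_poly:
  fixes p :: "mon \<Rightarrow>\<^sub>0 'k::field"
  assumes A: "A \<subseteq> monomials r"
  shows "p \<in> Idl\<^bsub>mpoly_ring r\<^esub> (mon_poly ` A) \<longleftrightarrow>
           Poly_Mapping.keys p \<subseteq> monomials r \<and> (\<forall>m\<in>Poly_Mapping.keys p. \<exists>a\<in>A. \<exists>b. m = a + b)"
proof -
  let ?R = "mpoly_ring r :: (mon \<Rightarrow>\<^sub>0 'k) ring"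
  define J :: "(mon \<Rightarrow>\<^sub>0 'k) set" where
    "J = {p. Poly_Mapping.keys p \<subseteq> monomials r \<and> (\<forall>m\<in>Poly_Mapping.keys p. \<exists>a\<in>A. \<exists>b. m = a + b)}"
  interpret R: cring ?R by (rule cring_mpoly_ring)
  have Jmult: "x * a \<in> J" if "a \<in> J" "Poly_Mapping.keys x \<subseteq> monomials r" for a x
    unfolding J_def
  proof safe
    fix m assume "m \<in> Poly_Mapping.keys (x * a)"
    with keys_mult[of x a] obtain u w where uw: "m = u + w" "u \<in> Poly_Mapping.keys x" "w \<in> Poly_Mapping.keys a"
      by auto
    then obtain c b where "c \<in> A" "w = c + b" using \<open>a \<in> J\<close> unfolding J_def by blast
    then show "\<exists>a\<in>A. \<exists>b. m = a + b" using uw by (intro bexI[of _ c] exI[of _ "u + b"]) (auto simp: add_ac)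
    show "m \<in> monomials r" using uw that by (auto simp: J_def)
  qed
  have Jadd: "x + y \<in> J" if "x \<in> J" "y \<in> J" for x y
    using that keys_add[of x y] by (fastforce simp: J_def)
  have "ideal J ?R"
  proof (rule idealI)
    show "ring ?R" by (rule R.ring_axioms)
    show "subgroup J (add_monoid ?R)"
    proof (rule R.add.subgroupI)
      show "J \<subseteq> carrier (mpoly_ring r)" by (auto simp: J_def mpoly_ring_def)
      have "0 \<in> J" by (simp add: J_def)
      then show "J \<noteq> {}" by blast
    next
      fix x assume x: "x \<in> J"
      have "- x \<in> J" using x by (auto simp: J_def in_keys_iff subset_iff)
      moreover have "\<ominus>\<^bsub>?R\<^esub> x = - x"
        by (rule R.minus_equality) (use x \<open>- x \<in> J\<close> in \<open>auto simp: mpoly_ring_def J_def\<close>)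
      ultimately show "\<ominus>\<^bsub>?R\<^esub> x \<in> J" by simp
    next
      fix x y assume "x \<in> J" "y \<in> J"
      then show "x \<oplus>\<^bsub>?R\<^esub> y \<in> J" using Jadd by (auto simp: mpoly_ring_def)
    qed
  next
    fix a x assume ax: "a \<in> J" "x \<in> carrier ?R"
    have "x * a \<in> J" using ax Jmult by (auto simp: mpoly_ring_def)
    then show "x \<otimes>\<^bsub>?R\<^esub> a \<in> J" "a \<otimes>\<^bsub>?R\<^esub> x \<in> J" by (auto simp: mpoly_ring_def mult_ac)
  qed
  moreover have "mon_poly ` A \<subseteq> J" 
    using A by (auto simp: J_def mon_poly_def intro: exI[of _ 0] intro!: bexI)
  ultimately have 1: "Idl\<^bsub>?R\<^esub> (mon_poly ` A) \<subseteq> J" by (rule R.genideal_minimal)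
  have Asub: "mon_poly ` A \<subseteq> carrier ?R" using A by (auto simp: mpoly_ring_def mon_poly_def)
  interpret I: ideal "Idl\<^bsub>?R\<^esub> (mon_poly ` A)" ?R by (rule R.genideal_ideal[OF Asub])
  have 2: "p \<in> Idl\<^bsub>?R\<^esub> (mon_poly ` A)" if p: "p \<in> J" for p
  proof -
    have trm: "Poly_Mapping.single m c \<in> Idl\<^bsub>?R\<^esub> (mon_poly ` A)" if "m \<in> Poly_Mapping.keys p" for m c
    proof -
      obtain a b where ab: "a \<in> A" "m = a + b" using p \<open>m \<in> _\<close> unfolding J_def by blast
      have "m \<in> monomials r" using p \<open>m \<in> _\<close> unfolding J_def by blast
      then have "Poly_Mapping.single b c \<in> carrier ?R" 
        using ab by (auto simp: mpoly_ring_def)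
      moreover have "mon_poly a \<in> Idl\<^bsub>?R\<^esub> (mon_poly ` A)"
        using R.genideal_self[OF Asub] ab by blast
      ultimately have "mon_poly a \<otimes>\<^bsub>?R\<^esub> Poly_Mapping.single b c \<in> Idl\<^bsub>?R\<^esub> (mon_poly ` A)"
        by (intro I.I_r_closed)
      then show ?thesis using ab by (simp add: mpoly_ring_def mon_poly_def mult_single)
    qed
    have "(\<Sum>m\<in>F. Poly_Mapping.single m (Poly_Mapping.lookup p m)) \<in> Idl\<^bsub>?R\<^esub> (mon_poly ` A)"
      if "finite F" "F \<subseteq> Poly_Mapping.keys p" for F
      using that
    proof (induction F rule: finite_induct)
      case empty
      show ?case using I.zero_closed by (simp add: mpoly_ring_def)
    next
      case (insert m F)
      then show ?case using I.a_closed[OF trm] by (simp add: mpoly_ring_def)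
    qed
    from this[of "Poly_Mapping.keys p"] mpoly_eq_sum[of p] show ?thesis by simp
  qed
  show ?thesis using 1 2 by (auto simp: J_def)
qed

lemma mon_poly_mem_Idl:
  assumes "A \<subseteq> monomials r" "m \<in> monomials r"
  shows "(mon_poly m :: mon \<Rightarrow>\<^sub>0 'k::field) \<in> Idl\<^bsub>mpoly_ring r\<^esub> (mon_poly ` A) \<longleftrightarrow> (\<exists>a\<in>A. \<exists>b. m = a + b)"
  using assms by (subst mem_Idl_mon_poly) (auto simp: mon_poly_def)

lemma is_min_mon_gens_iff:
  fixes I :: "(mon \<Rightarrow>\<^sub>0 'k::field) set"
  assumes A: "A \<subseteq> monomials r" and I: "I = Idl\<^bsub>mpoly_ring r\<^esub> (mon_poly ` A)"
  shows "is_min_mon_gens r I G \<longleftrightarrow> G = {m \<in> A. \<forall>a\<in>A. (\<exists>b. m = a + b) \<longrightarrow> a = m}"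
proof -
  define M where "M = {m \<in> A. \<forall>a\<in>A. (\<exists>b. m = a + b) \<longrightarrow> a = m}"
  have MA: "M \<subseteq> A" and Mr: "M \<subseteq> monomials r" using A by (auto simp: M_def)
  have below: "\<exists>a\<in>M. \<exists>b. m = a + b" if "m \<in> A" for m
    using that
  proof (induction "\<Sum>i\<in>Poly_Mapping.keys m. Poly_Mapping.lookup m i" arbitrary: m rule: less_induct)
    case less
    show ?case
    proof (cases "m \<in> M")
      case True
      then show ?thesis by (intro bexI[of _ m] exI[of _ 0]) auto
    next
      case False
      then obtain a b where ab: "a \<in> A" "m = a + b" "a \<noteq> m" using less.prems unfolding M_def by blast
      let ?K = "Poly_Mapping.keys m"
      have sub: "(\<Sum>i\<in>?K. Poly_Mapping.lookup x i) = (\<Sum>i\<in>Poly_Mapping.keys x. Poly_Mapping.lookup x i)"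
        if "Poly_Mapping.keys x \<subseteq> ?K" for x :: mon
        by (rule sum.mono_neutral_right) (use that in \<open>auto simp: in_keys_iff\<close>)
      have b: "b \<noteq> 0" using ab by auto
      then have "Poly_Mapping.keys b \<noteq> {}" by simp
      then have "(\<Sum>i\<in>Poly_Mapping.keys b. Poly_Mapping.lookup b i) > 0"
        by (intro sum_pos) (auto simp: in_keys_iff)
      moreover have "(\<Sum>i\<in>?K. Poly_Mapping.lookup m i) =
          (\<Sum>i\<in>Poly_Mapping.keys a. Poly_Mapping.lookup a i) + (\<Sum>i\<in>Poly_Mapping.keys b. Poly_Mapping.lookup b i)"
        using sub[of a] sub[of b] ab(2) by (simp add: keys_add_nat lookup_add sum.distrib)
      ultimately obtain a' b' where "a' \<in> M" "a = a' + b'" using less.hyps[of a] ab(1) by auto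
      then show ?thesis using ab(2) by (intro bexI[of _ a'] exI[of _ "b' + b"]) (auto simp: add_ac)
    qed
  qed
  have "Idl\<^bsub>mpoly_ring r\<^esub> (mon_poly ` M) = I"
  proof -
    have "(\<exists>a\<in>M. \<exists>b. m = a + b) \<longleftrightarrow> (\<exists>a\<in>A. \<exists>b. m = a + b)" for m
      proof
      assume "\<exists>a\<in>A. \<exists>b. m = a + b"
      then obtain a b where ab: "a \<in> A" "m = a + b" by blast
      then obtain a' b' where "a' \<in> M" "a = a' + b'" using below by blast
      then show "\<exists>a\<in>M. \<exists>b. m = a + b" using ab by (intro bexI[of _ a'] exI[of _ "b' + b"]) (auto simp: add_ac)
    qed (use MA in blast)
    then show ?thesis unfolding I by (auto simp: mem_Idl_mon_poly[OF A] mem_Idl_mon_poly[OF Mr])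
  qed
  then have Mgen: "mon_generates r M I" using Mr by (simp add: mon_generates_def)
  have Msub: "M \<subseteq> H" if H: "mon_generates r H I" for H
  proof
    fix m assume m: "m \<in> M"
    have Hr: "H \<subseteq> monomials r" and HI: "I = Idl\<^bsub>mpoly_ring r\<^esub> (mon_poly ` H)"
      using H by (auto simp: mon_generates_def)
    have iff: "(\<exists>a\<in>H. \<exists>b. x = a + b) \<longleftrightarrow> (\<exists>a\<in>A. \<exists>b. x = a + b)" if "x \<in> monomials r" for x
      using mon_poly_mem_Idl[OF Hr that, where 'k = 'k] mon_poly_mem_Idl[OF A that, where 'k = 'k] HI I by simp
    have "\<exists>a\<in>A. \<exists>b. m = a + b" using m MA by (intro bexI[of _ m] exI[of _ 0]) auto
    then obtain h b where h: "h \<in> H" "m = h + b" using iff[of m] m Mr by blast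
    moreover have "\<exists>a\<in>H. \<exists>b. h = a + b" using h by (intro bexI[of _ h] exI[of _ 0]) auto
    ultimately obtain a c where a: "a \<in> A" "h = a + c" using iff[of h] Hr by blast
    have "m = a + (c + b)" using h a by (simp add: add_ac)
    then have "a = m" using m a unfolding M_def by blast
    then have "m + (c + b) = m + 0" using \<open>m = a + (c + b)\<close> by simp
    then have "c + b = 0" by (simp only: add_left_cancel)
    then have "Poly_Mapping.keys c \<union> Poly_Mapping.keys b = {}" using keys_add_nat[of c b] by simp
    then have "c = 0" by simp
    then have "h = m" using a(2) \<open>a = m\<close> by (simp only: add_0_right)
    then show "m \<in> H" using h(1) by (simp only:)
  qed
  show ?thesis unfolding M_def[symmetric] is_min_mon_gens_def using Mgen Msub by blast
qed

lemma ex1_min_mon_gens: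
  fixes I :: "(mon \<Rightarrow>\<^sub>0 'k::field) set"
  assumes "mon_generates r A I"
  shows "\<exists>!G. is_min_mon_gens r I G"
  using assms is_min_mon_gens_iff[of A r I] by (auto simp: mon_generates_def)

lemma nth_prime_ge_2: "nth_prime i \<ge> 2"
  using enumerate_in_set[OF primes_infinite, of "i - 1"] by (auto simp: nth_prime_def prime_ge_2_nat)

lemma finite_min_mon_gens: "finite (min_mon_gens (prime_pi n) (weight_ideal n :: (mon \<Rightarrow>\<^sub>0 'k::field) set))"
proof -
  let ?r = "prime_pi n"
  let ?I = "weight_ideal n :: (mon \<Rightarrow>\<^sub>0 'k) set"
  define A where "A = {m \<in> monomials ?r. weight m > n}"
  define M where "M = {m \<in> A. \<forall>a\<in>A. (\<exists>b. m = a + b) \<longrightarrow> a = m}"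
  have "is_min_mon_gens ?r ?I G \<longleftrightarrow> G = M" for G
    unfolding M_def by (rule is_min_mon_gens_iff) (auto simp: A_def weight_ideal_def)
  then have eq: "min_mon_gens ?r ?I = M" by (simp add: min_mon_gens_def)
  have "Poly_Mapping.lookup m i \<le> n + 1" if m: "m \<in> M" for m i
  proof (rule ccontr)
    assume big: "\<not> Poly_Mapping.lookup m i \<le> n + 1"
    define a where "a = m - Poly_Mapping.single i 1"
    have m_eq: "m = a + Poly_Mapping.single i 1"
      using big by (intro poly_mapping_eqI) (auto simp: a_def lookup_add lookup_minus lookup_single when_def)
    have a: "Poly_Mapping.lookup a i \<ge> n + 1" using big m_eq by (simp add: lookup_add)
    have "m \<in> monomials ?r" using m by (simp add: M_def A_def)
    then have "a \<in> monomials ?r" by (subst (asm) m_eq) simp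
    moreover have "weight a > n"
    proof -
      have "n < 2 ^ n" by (rule less_exp)
      also have "(2::nat) ^ n \<le> 2 ^ Poly_Mapping.lookup a i" using a by (intro power_increasing) auto
      also have "\<dots> \<le> nth_prime i ^ Poly_Mapping.lookup a i" by (intro power_mono nth_prime_ge_2) auto
      also have "\<dots> \<le> weight a"
      proof -
        have pos: "nth_prime j > 0" for j using nth_prime_ge_2[of j] by simp
        then have "weight a > 0" by (auto simp: weight_def intro!: prod_pos)
        moreover have "i \<in> Poly_Mapping.keys a" using a by (simp add: in_keys_iff)
        then have "nth_prime i ^ Poly_Mapping.lookup a i dvd weight a"
          unfolding weight_def by (intro dvd_prodI) auto
        ultimately show ?thesis by (intro dvd_imp_le)
      qed
      finally show ?thesis .
    qed
    ultimately have "a \<in> A" by (simp add: A_def)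
    then have "a = m" using m m_eq unfolding M_def by blast
    then have "Poly_Mapping.lookup m i = Poly_Mapping.lookup m i + 1"
      using m_eq by (metis lookup_add lookup_single_eq)
    then show False by simp
  qed
  then have "Poly_Mapping.lookup ` M \<subseteq> {f. \<forall>i. (i \<in> {1..?r} \<longrightarrow> f i \<in> {..n + 1}) \<and> (i \<notin> {1..?r} \<longrightarrow> f i = 0)}"
    by (fastforce simp: M_def A_def monomials_def in_keys_iff subset_iff)
  then have "finite (Poly_Mapping.lookup ` M)"
    by (rule finite_subset) (intro finite_set_of_finite_funs, auto)
  moreover have "inj_on Poly_Mapping.lookup M"
    by (rule inj_onI) (simp only: poly_mapping_eq_iff)
  ultimately have "finite M" by (rule finite_imageD)
  then show ?thesis by (simp only: eq)
qed

end

theory Submission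
  imports Defs HOL.Rat
begin

text \<open>
  A monomial \<open>m \<noteq> 1\<close> with least index \<open>v\<close> is a minimal generator of \<open>I\<^sub>n\<close> iff
  \<open>n < w(m) \<le> n p\<^sub>v\<close>. Since \<open>n\<close> is not prime, \<open>I\<^sub>n\<close> and \<open>I\<^sub>n\<^sub>-\<^sub>1\<close> live in the same ring, and as \<open>p\<^sub>v\<close>
  divides \<open>w(m)\<close>, the generators with least index \<open>v\<close> differ only in those of weight \<open>n\<close>
  (lost) and \<open>n p\<^sub>v\<close> (gained). Both weights are even, so neither occurs when \<open>v \<ge> 2\<close>; when \<open>v = 1\<close>
  multiplication by \<open>x\<^sub>1\<close> is a bijection between the two.
\<close>

section \<open>Arithmetic of weights\<close>

lemma weight_superset:
  assumes "finite K" "Poly_Mapping.keys m \<subseteq> K"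
  shows "weight m = (\<Prod>i\<in>K. nth_prime i ^ Poly_Mapping.lookup m i)"
  unfolding weight_def
  by (rule prod.mono_neutral_left) (use assms in \<open>auto simp: in_keys_iff\<close>)

lemma weight_add: "weight (a + b) = weight a * weight b"
proof -
  let ?K = "Poly_Mapping.keys a \<union> Poly_Mapping.keys b"
  have "weight (a + b) = (\<Prod>i\<in>?K. nth_prime i ^ Poly_Mapping.lookup (a + b) i)"
    by (rule weight_superset) (auto simp: keys_add_nat)
  also have "\<dots> = (\<Prod>i\<in>?K. nth_prime i ^ Poly_Mapping.lookup a i) *
      (\<Prod>i\<in>?K. nth_prime i ^ Poly_Mapping.lookup b i)"
    by (simp add: lookup_add power_add prod.distrib)
  also have "\<dots> = weight a * weight b"
    using weight_superset[of ?K a] weight_superset[of ?K b] by simp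
  finally show ?thesis .
qed

lemma weight_single: "weight (Poly_Mapping.single i 1) = nth_prime i"
  by (simp add: weight_def)

lemma weight_zero: "weight 0 = 1"
  by (simp add: weight_def)

lemma weight_pos: "weight m > 0"
proof -
  have "nth_prime i > 0" for i
    using nth_prime_ge_2[of i] by simp
  then show ?thesis by (auto simp: weight_def intro!: prod_pos)
qed

lemma prime_nth_prime: "prime (nth_prime i)"
  using enumerate_in_set[OF primes_infinite, of "i - 1"] by (auto simp: nth_prime_def)

lemma nth_prime_mono: "i \<le> j \<Longrightarrow> nth_prime i \<le> nth_prime j"
  by (simp add: nth_prime_def primes_infinite)

lemma nth_prime_1: "nth_prime 1 = 2" "nth_prime (Suc 0) = 2"
proof -
  have "(LEAST p :: nat. prime p) = 2"
    by (rule Least_equality) (auto simp: prime_ge_2_nat)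
  then show "nth_prime 1 = 2" "nth_prime (Suc 0) = 2"
    by (simp_all add: nth_prime_def enumerate_0)
qed

lemma odd_nth_prime:
  assumes "i \<ge> 2"
  shows "odd (nth_prime i)"
proof -
  have "nth_prime 1 < nth_prime i"
    unfolding nth_prime_def by (rule enumerate_mono) (use assms primes_infinite in auto)
  then have "2 < nth_prime i" by (simp add: nth_prime_1)
  then show ?thesis by (rule prime_odd_nat[OF prime_nth_prime])
qed

lemma odd_weight:
  assumes "\<And>i. i \<in> Poly_Mapping.keys m \<Longrightarrow> i \<ge> 2"
  shows "odd (weight m)"
  unfolding weight_def using assms odd_nth_prime by (auto simp: even_prod_iff)

lemma min_index_in_keys:
  assumes "m \<noteq> 0"
  shows "min_index m \<in> Poly_Mapping.keys m"
proof -
  obtain i where "i \<in> Poly_Mapping.keys m" using assms by fastforce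
  then have "Poly_Mapping.lookup m i > 0" by (simp add: in_keys_iff)
  then have "Poly_Mapping.lookup m (min_index m) > 0"
    unfolding min_index_def by (rule LeastI)
  then show ?thesis by (simp add: in_keys_iff)
qed

lemma min_index_le: "i \<in> Poly_Mapping.keys m \<Longrightarrow> min_index m \<le> i"
  unfolding min_index_def by (rule Least_le) (simp add: in_keys_iff)

lemma split_off_index:
  fixes m :: mon
  assumes "i \<in> Poly_Mapping.keys m"
  obtains a where "m = a + Poly_Mapping.single i 1" "weight m = weight a * nth_prime i"
proof
  show m: "m = (m - Poly_Mapping.single i 1) + Poly_Mapping.single i 1"
    using assms
    by (intro poly_mapping_eqI) (auto simp: lookup_add lookup_minus lookup_single when_def in_keys_iff)
  show "weight m = weight (m - Poly_Mapping.single i 1) * nth_prime i"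
    by (subst m) (simp only: weight_add weight_single)
qed

text \<open>Meant for the cofactor of a proper divisor: \<open>b\<close> contains some variable, and
  its prime divides \<open>weight b\<close> and is at least \<open>nth_prime v\<close>.\<close>

lemma nth_prime_le_weight:
  assumes "b \<noteq> 0" "\<And>i. i \<in> Poly_Mapping.keys b \<Longrightarrow> v \<le> i"
  shows "nth_prime v \<le> weight b"
proof -
  obtain a where a: "weight b = weight a * nth_prime (min_index b)"
    using split_off_index[OF min_index_in_keys[OF assms(1)]] .
  have "nth_prime v \<le> nth_prime (min_index b)"
    by (rule nth_prime_mono, rule assms(2), rule min_index_in_keys[OF assms(1)])
  also have "\<dots> \<le> weight a * nth_prime (min_index b)"
    using weight_pos[of a] by simp
  also have "\<dots> = weight b"
    using a by simp
  finally show ?thesis .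
qed

section \<open>Minimal generators of the weight ideal\<close>

lemma min_mon_gens_weight_ideal:
  fixes n :: nat
  defines "A \<equiv> {m \<in> monomials (prime_pi n). weight m > n}"
  shows "min_mon_gens (prime_pi n) (weight_ideal n :: (mon \<Rightarrow>\<^sub>0 'k::field) set) =
    {m \<in> A. \<forall>a\<in>A. (\<exists>b. m = a + b) \<longrightarrow> a = m}" (is "_ = ?M")
proof -
  have "is_min_mon_gens (prime_pi n) (weight_ideal n :: (mon \<Rightarrow>\<^sub>0 'k) set) G \<longleftrightarrow> G = ?M" for G
    by (rule is_min_mon_gens_iff) (auto simp: A_def weight_ideal_def)
  then show ?thesis by (simp add: min_mon_gens_def)
qed

text \<open>The heaviest proper divisor of \<open>m\<close> arises by removing one copy of its
  variable of least index, as this variable carries the smallest prime. Minimality therefore only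
  requires that this one divisor has weight at most \<open>n\<close>.\<close>

lemma mem_min_mon_gens_iff:
  fixes m :: mon
  assumes "m \<noteq> 0"
  shows "m \<in> min_mon_gens (prime_pi n) (weight_ideal n :: (mon \<Rightarrow>\<^sub>0 'k::field) set) \<longleftrightarrow>
    m \<in> monomials (prime_pi n) \<and> n < weight m \<and> weight m \<le> n * nth_prime (min_index m)"
    (is "?L \<longleftrightarrow> ?R")
proof
  let ?v = "min_index m"
  assume ?L
  then have m: "m \<in> monomials (prime_pi n)" "n < weight m"
    and min: "\<And>a b. a \<in> monomials (prime_pi n) \<Longrightarrow> n < weight a \<Longrightarrow> m = a + b \<Longrightarrow> a = m"
    by (auto simp: min_mon_gens_weight_ideal)
  obtain a where a: "m = a + Poly_Mapping.single ?v 1"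
    and wa: "weight m = weight a * nth_prime ?v"
    using split_off_index[OF min_index_in_keys[OF assms]] .
  have "a \<noteq> m"
  proof
    assume "a = m"
    then have "weight m * 1 = weight m * nth_prime ?v" using wa by simp
    then show False using weight_pos[of m] nth_prime_ge_2[of ?v] by simp
  qed
  moreover have "a \<in> monomials (prime_pi n)"
    using m(1) by (subst (asm) a) simp
  ultimately have "weight a \<le> n" using min[OF _ _ a] by force
  then show ?R using m wa by simp
next
  assume R: ?R
  have "a = m" if a: "n < weight a" "m = a + b" for a b
  proof (rule ccontr)
    assume "a \<noteq> m"
    then have "b \<noteq> 0" using a(2) by auto
    moreover have "min_index m \<le> i" if "i \<in> Poly_Mapping.keys b" for i
      by (rule min_index_le) (use that a(2) in \<open>simp add: keys_add_nat\<close>)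
    ultimately have le: "nth_prime (min_index m) \<le> weight b"
      by (rule nth_prime_le_weight)
    \<comment> \<open>A proper divisor \<open>a\<close> heavier than \<open>n\<close> would push
      \<open>weight m = weight a * weight b\<close> above the upper bound in
      \<open>?R\<close>.\<close>
    have "n * nth_prime (min_index m) < weight a * nth_prime (min_index m)"
      using a(1) nth_prime_ge_2[of "min_index m"] by simp
    also have "\<dots> \<le> weight a * weight b" using le by simp
    also have "\<dots> = weight m" using a(2) by (simp add: weight_add)
    finally show False using R by simp
  qed
  then show ?L using R by (auto simp: min_mon_gens_weight_ideal)
qed

text \<open>This description does not mention the field, so the numbers of generators are the same
  over every \<open>'k\<close>.\<close>

definition gens :: "nat \<Rightarrow> nat \<Rightarrow> mon set" where
  "gens n v = {m \<in> monomials (prime_pi n).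
     m \<noteq> 0 \<and> min_index m = v \<and> n < weight m \<and> weight m \<le> n * nth_prime v}"

lemma min_mon_gens_eq_gens:
  "{m \<in> min_mon_gens (prime_pi n) (weight_ideal n :: (mon \<Rightarrow>\<^sub>0 'k::field) set).
     m \<noteq> 0 \<and> min_index m = v} = gens n v"
  by (auto simp: gens_def mem_min_mon_gens_iff)

lemma num_gens_eq: "num_gens TYPE('k::field_char_0) n v = card (gens n v)"
  by (simp add: num_gens_def min_mon_gens_eq_gens)

lemma gens_empty: "v > prime_pi n \<Longrightarrow> gens n v = {}"
  using min_index_in_keys by (fastforce simp: gens_def monomials_def)

section \<open>Passing from n - 1 to n\<close>

lemma prime_pi_pred:
  assumes "\<not> prime n"
  shows "prime_pi (n - 1) = prime_pi n"
proof -
  have "p \<le> n - 1 \<longleftrightarrow> p \<le> n" if "prime p" for p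
    using that assms by (cases "p = n") auto
  then have "{p. prime p \<and> p \<le> n - 1} = {p. prime p \<and> p \<le> n}" by blast
  then show ?thesis by (simp add: prime_pi_def)
qed

lemma nth_prime_dvd_weight:
  assumes "m \<noteq> 0"
  shows "nth_prime (min_index m) dvd weight m"
proof -
  obtain a where "weight m = weight a * nth_prime (min_index m)"
    using split_off_index[OF min_index_in_keys[OF assms]] .
  then show ?thesis by simp
qed

text \<open>No multiple of \<open>p\<^sub>v\<close> lies strictly between \<open>(n - 1) p\<^sub>v\<close> and \<open>n p\<^sub>v\<close>.\<close>

lemma gens_diff_eq:
  assumes "n \<ge> 2" "\<not> prime n"
  shows "gens (n - 1) v - {m. weight m = n} = gens n v - {m. weight m = n * nth_prime v}"
proof (rule Set.set_eqI)
  fix m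
  have "weight m \<le> (n - 1) * nth_prime v \<longleftrightarrow> weight m < n * nth_prime v"
    if m: "m \<noteq> 0" "min_index m = v"
  proof -
    obtain k where k: "weight m = nth_prime v * k"
      using nth_prime_dvd_weight[OF m(1)] m(2) by auto
    show ?thesis using k nth_prime_ge_2[of v] assms(1) by (auto simp: mult.commute)
  qed
  moreover have "n - 1 < weight m \<and> weight m \<noteq> n \<longleftrightarrow> n < weight m" using assms(1) by auto
  ultimately show "m \<in> gens (n - 1) v - {m. weight m = n} \<longleftrightarrow>
      m \<in> gens n v - {m. weight m = n * nth_prime v}"
    unfolding gens_def prime_pi_pred[OF assms(2)] by auto
qed

text \<open>The only even prime is 2, the weight of the first variable, so an even weight forces
  that variable to occur.\<close>

lemma min_index_eq_1_iff:
  assumes "m \<in> monomials r" "m \<noteq> 0"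
  shows "min_index m = 1 \<longleftrightarrow> even (weight m)"
proof
  assume "min_index m = 1"
  then show "even (weight m)" using nth_prime_dvd_weight[OF assms(2)] by (simp only: nth_prime_1)
next
  assume ev: "even (weight m)"
  then obtain i where i: "i \<in> Poly_Mapping.keys m" "\<not> i \<ge> 2"
    using odd_weight by blast
  moreover have "min_index m \<ge> 1"
    using assms min_index_in_keys[OF assms(2)] by (auto simp: monomials_def)
  ultimately show "min_index m = 1" using min_index_le[OF i(1)] by simp
qed

lemma nonzero_if_even_weight: "even (weight m) \<Longrightarrow> m \<noteq> 0"
  by (auto simp: weight_zero)

text \<open>The lost and the gained generators are full weight classes: even weight forces
  \<open>m \<noteq> 0\<close> and least index 1, and the bounds hold because
  \<open>n - 1 < n \<le> (n - 1) * 2\<close> and \<open>n < n * 2\<close>.\<close>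

lemma gens_weight_eq:
  assumes "n \<ge> 2" "even n" "\<not> prime n"
  shows "gens (n - 1) 1 \<inter> {m. weight m = n} = {m \<in> monomials (prime_pi n). weight m = n}"
    and "gens n 1 \<inter> {m. weight m = n * 2} = {m \<in> monomials (prime_pi n). weight m = n * 2}"
proof -
  have "m \<noteq> 0 \<and> min_index m = 1" if "m \<in> monomials r" "even (weight m)" for m r
    using that nonzero_if_even_weight min_index_eq_1_iff by blast
  then show "gens (n - 1) 1 \<inter> {m. weight m = n} = {m \<in> monomials (prime_pi n). weight m = n}"
    and "gens n 1 \<inter> {m. weight m = n * 2} = {m \<in> monomials (prime_pi n). weight m = n * 2}"
    unfolding gens_def prime_pi_pred[OF assms(3)] nth_prime_1 using assms(1,2) by (auto simp: weight_zero)
qed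

lemma bij_betw_mult_x1:
  assumes "r \<ge> 1"
  shows "bij_betw (\<lambda>m. m + Poly_Mapping.single 1 1)
    {m \<in> monomials r. weight m = n} {m \<in> monomials r. weight m = n * 2}"
proof (rule bij_betw_imageI)
  show "inj_on (\<lambda>m. m + Poly_Mapping.single 1 1) {m \<in> monomials r. weight m = n}"
    by (rule inj_onI) simp
  have w: "weight (a + Poly_Mapping.single 1 1) = weight a * 2" for a
    by (simp only: weight_add weight_single nth_prime_1)
  have x1: "Poly_Mapping.single 1 1 \<in> monomials r" using assms by (simp add: monomials_def)
  have "m \<in> (\<lambda>m. m + Poly_Mapping.single 1 1) ` {m \<in> monomials r. weight m = n}"
    if m: "m \<in> monomials r" "weight m = n * 2" for m
  proof -
    \<comment> \<open>Surjectivity: even weight makes \<open>m\<close> divisible by the first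
      variable, and the quotient is the preimage.\<close>
    have "even (weight m)" using m by simp
    then have "m \<noteq> 0" "min_index m = 1"
      using nonzero_if_even_weight min_index_eq_1_iff[OF m(1)] by blast+
    then obtain a where a: "m = a + Poly_Mapping.single 1 1"
      using split_off_index min_index_in_keys by metis
    have "a \<in> monomials r" "weight a = n" using m w unfolding a by auto
    then show ?thesis using a by blast
  qed
  then show "(\<lambda>m. m + Poly_Mapping.single 1 1) ` {m \<in> monomials r. weight m = n} =
      {m \<in> monomials r. weight m = n * 2}"
    using w x1 by auto
qed

lemma gens_no_even_weight:
  assumes "v \<ge> 2" "m \<in> gens n v"
  shows "odd (weight m)"
  using assms min_index_le[of _ m] by (intro odd_weight) (force simp: gens_def)

lemma card_gens_eq:
  assumes "n \<ge> 4" "even n" "1 \<le> v" "v \<le> prime_pi n"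
  shows "card (gens n v) = card (gens (n - 1) v)"
proof -
  have np: "\<not> prime n" using assms(1,2) prime_odd_nat[of n] by auto
  have n2: "n \<ge> 2" using assms(1) by simp
  note diff = gens_diff_eq[OF n2 np, of v]
  show ?thesis
  proof (cases "v = 1")
    case False
    \<comment> \<open>Both \<open>n\<close> and \<open>n * nth_prime v\<close> are even, while
      generators with least index at least 2 have odd weight. Nothing is removed in
      \<open>diff\<close>, so the two sets of generators coincide.\<close>
    then have "gens (n - 1) v \<inter> {m. weight m = n} = {}" "gens n v \<inter> {m. weight m = n * nth_prime v} = {}"
      using gens_no_even_weight[of v] assms(2,3) by fastforce+
    then show ?thesis using diff by (metis Diff_triv)
  next
    case True
    have split: "card G = card (G \<inter> W) + card (G - W)" if "finite G" for G W :: "mon set"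
      using card_Int_Diff[OF that] .
    \<comment> \<open>Finiteness is known for the generators over a field; since \<open>gens\<close>
      is independent of the field, the rationals serve as an instance.\<close>
    have fin: "finite (gens k v)" for k
      unfolding min_mon_gens_eq_gens[where 'k = rat, symmetric]
      by (rule finite_subset[OF _ finite_min_mon_gens[where 'k = rat]]) auto
    have "card (gens (n - 1) v \<inter> {m. weight m = n}) = card (gens n v \<inter> {m. weight m = n * 2})"
      unfolding True gens_weight_eq[OF n2 assms(2) np]
      \<comment> \<open>The first variable belongs to the ring because
        \<open>1 \<le> v \<le> prime_pi n\<close>.\<close>
      by (rule bij_betw_same_card[OF bij_betw_mult_x1]) (use assms(3,4) in simp)
    moreover have "gens (n - 1) v - {m. weight m = n} = gens n v - {m. weight m = n * 2}"
      using diff True by (simp only: nth_prime_1)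
    ultimately show ?thesis
      using split[OF fin, of n "{m. weight m = n * 2}"] split[OF fin, of "n - 1" "{m. weight m = n}"]
      by simp
  qed
qed

theorem proposition11:
  fixes n :: nat
  assumes "n \<ge> 4" and "even n"
  shows "(\<forall>v. 1 \<le> v \<and> v \<le> prime_pi n \<longrightarrow>
            num_gens TYPE('k::field_char_0) n v = num_gens TYPE('k) (n - 1) v) \<and>
         (\<forall>v. v > prime_pi n \<longrightarrow>
            num_gens TYPE('k) n v = 0 \<and> num_gens TYPE('k) (n - 1) v = 0)"
proof -
  have "\<not> prime n" using assms prime_odd_nat[of n] by auto
  then have "gens (n - 1) v = {}" if "v > prime_pi n" for v
    using that prime_pi_pred by (intro gens_empty) simp
  then show ?thesis
    using card_gens_eq[OF assms] by (auto simp: num_gens_eq gens_empty)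
qed

end
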